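(* Let $\mathcal{M} = \mathcal{SO}(3)\times\mathbb{R}^3\times\mathcal{SO}(3)$ with elements $\xi=((\mathbf{R},\boldsymbol{b}),\mathbf{C})$, let $\mathbb{L}=\{(\boldsymbol{\omega},\mathbf{0},\mathbf{0}):\boldsymbol{\omega}\in\mathbb{R}^3\}\subset\mathbb{R}^9$, and consider the biased attitude system $\dot\xi=f_u(\xi)$, where for $u=(\boldsymbol{\omega},\mathbf{0},\mathbf{0})\in\mathbb{L}$ $$f_u(\xi)=\big(\mathbf{R}(\boldsymbol{\omega}-\boldsymbol{b})^{\wedge},\;\mathbf{0},\;\mathbf{0}^{\wedge}\big).$$ Let $\mathbf{G} = (\mathbf{SO}(3)\ltimes\mathfrak{so}(3))\times\mathbf{SO}(3)$ with elements $X=((A,a),B)$, and define $$\phi(X,\xi)=\big(\mathbf{R}A,\,A^{\top}(\boldsymbol{b}-a^{\vee}),\,A^{\top}\mathbf{C}B\big),\qquad \psi(X,u)=\big(A^{\top}(\boldsymbol{\omega}-a^{\vee}),\mathbf{0},\mathbf{0}\big).$$ Then the system is equivariant under the actions $\phi$ and $\psi$ of $\mathbf{G}$; that is, for all $X\in\mathbf{G}$, $u\in\mathbb{L}$ and $\xi\in\mathcal{M}$, $$f_{\psi_X(u)}(\xi)=\Phi_Xf_u(\xi).$$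
   Context: $\mathcal{SO}(3)$ denotes the underlying smooth manifold of the Lie group $\mathbf{SO}(3)$. For $\boldsymbol{v}\in\mathbb{R}^3$, $\boldsymbol{v}^{\wedge}\in\mathfrak{so}(3)$ is the skew-symmetric matrix with $\boldsymbol{v}^{\wedge}\boldsymbol{w}=\boldsymbol{v}\times\boldsymbol{w}$, and $(\cdot)^{\vee}$ is its inverse. The group product in $\mathbf{G}$ is $XY=((A_XA_Y,\,a_X+A_Xa_YA_X^{\top}),\,B_XB_Y)$, with inverse $X^{-1}=((A^{\top},-A^{\top}aA),B^{\top})$. The maps $\phi:\mathbf{G}\times\mathcal{M}\to\mathcal{M}$ and $\psi:\mathbf{G}\times\mathbb{L}\to\mathbb{L}$ are right group actions; write $\phi_X(\xi)=\phi(X,\xi)$ and $\psi_X(u)=\psi(X,u)$. For a smooth vector field $f$ on $\mathcal{M}$, the induced action is $\Phi_Xf=\Phi(X,f):=\mathrm{d}\phi_X\circ f\circ\phi_{X^{-1}}$. *)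

theory Defs
  imports "HOL-Analysis.Analysis" "HOL-Algebra.Group"
begin

type_synonym mat3 = "real^3^3"
type_synonym state = "(mat3 \<times> (real^3)) \<times> mat3"
type_synonym input = "(real^3) \<times> (real^3) \<times> (real^3)"
type_synonym symmetry = "(mat3 \<times> mat3) \<times> mat3"

definition SO3 :: "mat3 set" where
  "SO3 = {Q. rotation_matrix Q}"

definition so3 :: "mat3 set" where
  "so3 = {a. transpose a = - a}"

definition hat :: "real^3 \<Rightarrow> mat3" where
  "hat v = matrix (\<lambda>w. cross3 v w)"

text \<open>Meaningful on \<^term>\<open>so3\<close>, which is the range of \<^term>\<open>hat\<close> (lemma \<open>range_hat\<close> below).\<close>

definition vee :: "mat3 \<Rightarrow> real^3" where
  "vee = inv_into UNIV hat"

definition manifold_M :: "state set" where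
  "manifold_M = (SO3 \<times> UNIV) \<times> SO3"

text \<open>The nine-dimensional input space is written as a product of three copies of \<open>\<real>\<^sup>3\<close>.\<close>

definition inputs_L :: "input set" where
  "inputs_L = {u. \<exists>\<omega>. u = (\<omega>, 0, 0)}"

text \<open>Tangent vectors of \<^term>\<open>manifold_M\<close>, a submanifold of the Euclidean space \<^typ>\<open>state\<close>,
  are represented as elements of \<^typ>\<open>state\<close>.\<close>

fun f_sys :: "input \<Rightarrow> state \<Rightarrow> state" where
  "f_sys (\<omega>, _, _) ((R, b), C) = ((R ** hat (\<omega> - b), 0), hat 0)"

definition SO3_group :: "mat3 monoid" where
  "SO3_group = \<lparr>carrier = SO3, mult = (**), one = mat 1\<rparr>"

definition semidirect_group :: "(mat3 \<times> mat3) monoid" where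
  "semidirect_group =
    \<lparr>carrier = SO3 \<times> so3,
     mult = (\<lambda>(A, a) (A', a'). (A ** A', a + A ** a' ** transpose A)),
     one = (mat 1, 0)\<rparr>"

definition symmetry_G :: "symmetry monoid" where
  "symmetry_G = semidirect_group \<times>\<times> SO3_group"

fun phi :: "symmetry \<Rightarrow> state \<Rightarrow> state" where
  "phi ((A, a), B) ((R, b), C) =
    ((R ** A, transpose A *v (b - vee a)), transpose A ** C ** B)"

fun psi :: "symmetry \<Rightarrow> input \<Rightarrow> input" where
  "psi ((A, a), B) (\<omega>, _, _) = (transpose A *v (\<omega> - vee a), 0, 0)"

definition smooth_curve :: "(real \<Rightarrow> 'a::real_normed_vector) \<Rightarrow> bool" where
  "smooth_curve \<gamma> \<longleftrightarrow>
    (\<exists>D. D 0 = \<gamma> \<and> (\<forall>n t. (D n has_vector_derivative D (Suc n) t) (at t)))"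

definition curve_with_velocity ::
    "'a::real_normed_vector set \<Rightarrow> 'a \<Rightarrow> 'a \<Rightarrow> (real \<Rightarrow> 'a) \<Rightarrow> bool" where
  "curve_with_velocity S p v \<gamma> \<longleftrightarrow>
    smooth_curve \<gamma> \<and> range \<gamma> \<subseteq> S \<and> \<gamma> 0 = p \<and> (\<gamma> has_vector_derivative v) (at 0)"

text \<open>The differential at \<open>p\<close> of a map \<open>F\<close> on an embedded submanifold \<open>S\<close>: a tangent vector
  \<open>v\<close>, i.e. the velocity of some smooth curve in \<open>S\<close> through \<open>p\<close>, is sent to the velocity of the
  image curve. The value is unspecified if \<open>v\<close> is not tangent to \<open>S\<close> at \<open>p\<close>.\<close>

definition differential ::
    "'a::real_normed_vector set \<Rightarrow> ('a \<Rightarrow> 'b::real_normed_vector) \<Rightarrow> 'a \<Rightarrow> 'a \<Rightarrow> 'b" where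
  "differential S F p v =
    (THE w. \<forall>\<gamma>. curve_with_velocity S p v \<gamma> \<longrightarrow> ((F \<circ> \<gamma>) has_vector_derivative w) (at 0))"

definition induced_action :: "symmetry \<Rightarrow> (state \<Rightarrow> state) \<Rightarrow> state \<Rightarrow> state" where
  "induced_action X f \<xi> =
    (let \<eta> = phi (inv\<^bsub>symmetry_G\<^esub> X) \<xi> in differential manifold_M (phi X) \<eta> (f \<eta>))"

lemma hat_mult_vec: "hat v *v w = cross3 v w"
  using bilinear_cross by (auto simp: hat_def bilinear_def matrix_works)

lemma inj_hat: "inj hat"
proof (rule injI)
  fix v w assume "hat v = hat w"
  then have "cross3 v x = cross3 w x" for x by (metis hat_mult_vec)
  from this[of "axis 1 1"] this[of "axis 2 1"] show "v = w"
    by (simp add: cross3_simps forall_3 axis_def)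
qed

lemma vee_hat [simp]: "vee (hat v) = v"
  by (simp add: vee_def inj_hat)

lemma hat_explicit:
  "hat v = vector [vector [0, - v$3, v$2], vector [v$3, 0, - v$1], vector [- v$2, v$1, 0]]"
  by (simp add: hat_def matrix_def cross3_simps forall_3 axis_def)

lemma so3_iff: "a \<in> so3 \<longleftrightarrow> (\<forall>i j. a$j$i = - a$i$j)"
  by (simp add: so3_def transpose_def vec_eq_iff)

lemma range_hat: "range hat = so3"
proof
  show "range hat \<subseteq> so3"
    by (auto simp: so3_iff hat_explicit forall_3)
  show "so3 \<subseteq> range hat"
  proof
    fix a assume "a \<in> so3"
    then have "a$1$1 = 0" "a$2$2 = 0" "a$3$3 = 0" "a$1$2 = - a$2$1" "a$3$1 = - a$1$3" "a$2$3 = - a$3$2"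
      unfolding so3_iff forall_3 by linarith+
    then have "a = hat (vector [a$3$2, a$1$3, a$2$1])"
      by (simp add: hat_explicit vec_eq_iff forall_3)
    then show "a \<in> range hat" by blast
  qed
qed

lemma hat_add: "hat (v + w) = hat v + hat w" 
  by (simp add: hat_explicit vec_eq_iff forall_3)

lemma SO3_D: assumes "A \<in> SO3"
  shows "transpose A ** A = mat 1" "A ** transpose A = mat 1"
  using assms by (auto simp: SO3_def rotation_matrix_def orthogonal_matrix_def)

lemma hat_conj:
  assumes "A \<in> SO3" shows "A ** hat v ** transpose A = hat (A *v v)"
proof -
  have "(A ** hat v ** transpose A) *v w = hat (A *v v) *v w" for w
  proof -
    have "(A ** hat v ** transpose A) *v w = A *v cross3 v (transpose A *v w)"
      by (simp add: hat_mult_vec flip: matrix_vector_mul_assoc)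
    also have "\<dots> = cross3 (A *v v) (A *v (transpose A *v w))"
      using assms by (simp add: SO3_def cross_rotation_matrix)
    also have "\<dots> = hat (A *v v) *v w"
      by (simp add: hat_mult_vec matrix_vector_mul_assoc SO3_D[OF assms] del: transpose_matrix_vector)
    finally show ?thesis .
  qed
  then show ?thesis by (simp add: matrix_eq)
qed

lemma SO3_closed:
  "mat 1 \<in> SO3" "A \<in> SO3 \<Longrightarrow> B \<in> SO3 \<Longrightarrow> A ** B \<in> SO3" "A \<in> SO3 \<Longrightarrow> transpose A \<in> SO3"
  unfolding SO3_def rotation_matrix_def mem_Collect_eq
  by (simp_all only: orthogonal_matrix_id orthogonal_matrix_mul orthogonal_matrix_transpose
      det_mul det_I det_transpose mult_1_left simp_thms)

lemma so3_closed:
  "0 \<in> so3" "a \<in> so3 \<Longrightarrow> b \<in> so3 \<Longrightarrow> a + b \<in> so3" "a \<in> so3 \<Longrightarrow> - a \<in> so3"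
  unfolding so3_iff zero_index vector_add_component vector_uminus_component
  by (simp, metis minus_add_distrib, metis)

lemma so3_conj:
  assumes "a \<in> so3"
  shows "A ** a ** transpose A \<in> so3" "transpose A ** a ** A \<in> so3"
proof -
  have neg: "A ** (- a) = - (A ** a)" "(- a) ** A = - (a ** A)" for A a :: mat3
    by (simp_all add: matrix_matrix_mult_def vec_eq_iff sum_negf)
  have a: "transpose a = - a" using assms by (simp add: so3_def)
  show "A ** a ** transpose A \<in> so3" "transpose A ** a ** A \<in> so3"
    unfolding so3_def
    by (simp_all add: matrix_transpose_mul a neg matrix_mul_assoc)
qed

lemma SO3_group: "group SO3_group"
  by (rule groupI) (auto simp: SO3_group_def SO3_closed matrix_mul_assoc intro!: bexI[OF _ SO3_closed(3)] SO3_D)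

lemma matrix_add_rdistrib: "(a + b) ** c = a ** c + b ** c" for a b c :: mat3
  by (simp add: matrix_matrix_mult_def vec_eq_iff sum.distrib distrib_right)

lemma semidirect_group: "group semidirect_group"
proof (rule groupI)
  fix x assume "x \<in> carrier semidirect_group"
  then obtain A a where x: "x = (A, a)" "A \<in> SO3" "a \<in> so3"
    by (auto simp: semidirect_group_def)
  show "\<exists>y\<in>carrier semidirect_group.
      y \<otimes>\<^bsub>semidirect_group\<^esub> x = \<one>\<^bsub>semidirect_group\<^esub>"
    using x
    by (intro bexI[of _ "(transpose A, - (transpose A ** a ** A))"])
       (auto simp: semidirect_group_def SO3_closed so3_closed so3_conj SO3_D)
qed (auto simp: semidirect_group_def SO3_closed so3_closed so3_conj matrix_mul_assoc
       matrix_add_ldistrib matrix_add_rdistrib matrix_transpose_mul)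

lemma symmetry_G_group: "group symmetry_G"
  unfolding symmetry_G_def by (intro DirProd_group semidirect_group SO3_group)

lemma carrier_symmetry_G: "carrier symmetry_G = (SO3 \<times> so3) \<times> SO3"
  by (simp add: symmetry_G_def semidirect_group_def SO3_group_def)

lemma mult_symmetry_G:
  "((A, a), B) \<otimes>\<^bsub>symmetry_G\<^esub> ((A', a'), B') =
    ((A ** A', a + A ** a' ** transpose A), B ** B')"
  by (simp add: symmetry_G_def semidirect_group_def SO3_group_def)

lemma one_symmetry_G: "\<one>\<^bsub>symmetry_G\<^esub> = ((mat 1, 0), mat 1)"
  by (simp add: symmetry_G_def semidirect_group_def SO3_group_def)

lemma inv_symmetry_G:
  assumes "((A, a), B) \<in> carrier symmetry_G"
  shows "inv\<^bsub>symmetry_G\<^esub> ((A, a), B) =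
    ((transpose A, - (transpose A ** a ** A)), transpose B)"
proof (rule group.inv_equality[OF symmetry_G_group _ assms])
  show "((transpose A, - (transpose A ** a ** A)), transpose B)
      \<otimes>\<^bsub>symmetry_G\<^esub> ((A, a), B) = \<one>\<^bsub>symmetry_G\<^esub>"
    using assms by (simp add: mult_symmetry_G one_symmetry_G carrier_symmetry_G SO3_D)
  show "((transpose A, - (transpose A ** a ** A)), transpose B) \<in> carrier symmetry_G"
    using assms by (simp add: carrier_symmetry_G SO3_closed so3_closed so3_conj)
qed

definition right_action ::
    "('g, 'm) monoid_scheme \<Rightarrow> 'x set \<Rightarrow> ('g \<Rightarrow> 'x \<Rightarrow> 'x) \<Rightarrow> bool" where
  "right_action G S \<alpha> \<longleftrightarrow>
    (\<forall>g\<in>carrier G. \<forall>x\<in>S. \<alpha> g x \<in> S) \<and>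
    (\<forall>x\<in>S. \<alpha> \<one>\<^bsub>G\<^esub> x = x) \<and>
    (\<forall>g\<in>carrier G. \<forall>h\<in>carrier G. \<forall>x\<in>S. \<alpha> h (\<alpha> g x) = \<alpha> (g \<otimes>\<^bsub>G\<^esub> h) x)"

lemma hat_vee: "a \<in> so3 \<Longrightarrow> hat (vee a) = a"
  by (simp add: vee_def f_inv_into_f range_hat)

lemma vee_zero: "vee 0 = 0"
proof -
  have "hat 0 = 0" by (simp add: hat_explicit vec_eq_iff forall_3)
  then show ?thesis using vee_hat[of 0] by simp
qed

lemma vee_mult:
  assumes "A \<in> SO3" "a \<in> so3" "a' \<in> so3"
  shows "vee (a + A ** a' ** transpose A) = vee a + A *v vee a'"
  by (metis assms hat_add hat_conj hat_vee vee_hat)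

lemma affine_part:
  assumes "A \<in> SO3" "a \<in> so3" "a' \<in> so3"
  shows "transpose A' *v (transpose A *v (b - vee a) - vee a') =
    transpose (A ** A') *v (b - vee (a + A ** a' ** transpose A))"
proof -
  have "transpose (A ** A') *v (b - vee (a + A ** a' ** transpose A)) =
      transpose A' *v (transpose A *v (b - vee a - A *v vee a'))"
    by (simp add: vee_mult[OF assms] matrix_transpose_mul matrix_vector_mul_assoc
        diff_diff_eq del: transpose_matrix_vector)
  also have "transpose A *v (b - vee a - A *v vee a') = transpose A *v (b - vee a) - vee a'"
    by (simp add: matrix_vector_mult_diff_distrib[of _ _ "A *v vee a'"] matrix_vector_mul_assoc
        SO3_D[OF assms(1)] del: transpose_matrix_vector)
  finally show ?thesis by simp
qed

lemma phi_right_action: "right_action symmetry_G manifold_M phi"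
  unfolding right_action_def carrier_symmetry_G manifold_M_def
  by (auto simp: one_symmetry_G mult_symmetry_G SO3_closed affine_part vee_zero
      matrix_mul_assoc matrix_transpose_mul[of _ "_ :: mat3"] simp del: transpose_matrix_vector)

lemma psi_right_action: "right_action symmetry_G inputs_L psi"
  unfolding right_action_def carrier_symmetry_G inputs_L_def
  by (auto simp: one_symmetry_G mult_symmetry_G affine_part vee_zero
      simp del: transpose_matrix_vector)

end

theory Submission
  imports Defs
begin

text \<open>Each \<^term>\<open>phi X\<close> is the restriction of an affine map of the ambient space, so its differential
  at any tangent vector is the linear part, and the equivariance reduces to
  \<open>A\<^sup>T v\<^sup>\<wedge> A = (A\<^sup>T v)\<^sup>\<wedge>\<close>. Since the differential is specified through curves, one also needs that
  \<open>f\<^sub>u(\<xi>)\<close> is the velocity of a smooth curve in the manifold; the rotations about a fixed axis,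
  written in Rodrigues' form, provide it.\<close>

lemma linear_matrix_mul_right: "linear (\<lambda>M::mat3. M ** A)"
  by (rule linearI)
     (simp_all add: matrix_matrix_mult_def vec_eq_iff sum.distrib distrib_right sum_distrib_left mult.assoc)

lemma linear_matrix_mul_left: "linear (\<lambda>M::mat3. A ** M)"
  by (rule linearI)
     (simp_all add: matrix_matrix_mult_def vec_eq_iff sum.distrib distrib_left sum_distrib_left mult_ac)

lemma hat_zero [simp]: "hat 0 = 0"
  by (simp add: hat_explicit vec_eq_iff forall_3)

lemma hat_scaleR: "hat (c *\<^sub>R v) = c *\<^sub>R hat v"
  by (simp add: hat_explicit vec_eq_iff forall_3)

text \<open>For a unit vector \<open>k\<close> this is the exponential of
  \<open>x *\<^sub>R hat k\<close>. In closed form its dependence on \<open>x\<close> is purely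
  trigonometric.\<close>

definition rodrigues :: "real^3 \<Rightarrow> real \<Rightarrow> mat3" where
  "rodrigues k x = mat 1 + sin x *\<^sub>R hat k + (1 - cos x) *\<^sub>R (hat k ** hat k)"

text \<open>Cayley-Hamilton: the characteristic polynomial of \<open>hat k\<close> is t^3 + |k|^2
  t.\<close>

lemma hat_cubed: "hat k ** hat k ** hat k = - (norm k)\<^sup>2 *\<^sub>R hat k"
proof -
  have "(norm k)\<^sup>2 = k$1 * k$1 + k$2 * k$2 + k$3 * k$3"
    by (simp add: power2_norm_eq_inner inner_vec_def sum_3)
  then show ?thesis
    by (simp add: vec_eq_iff forall_3 hat_explicit matrix_matrix_mult_def sum_3 algebra_simps)
qed

lemma transpose_hat: "transpose (hat k) = - hat k"
  using range_hat by (auto simp: so3_def)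

text \<open>Since K^3 = -K for a unit axis, the span of 1, K and K^2 is closed under products; the
  coefficients combine by the addition formulas for sine and cosine.\<close>

lemma rodrigues_add:
  assumes "norm k = 1"
  shows "rodrigues k x ** rodrigues k y = rodrigues k (x + y)"
proof -
  define K where "K = hat k"
  define K2 where "K2 = K ** K"
  have K3: "K2 ** K = - K" "K ** K2 = - K" "K2 ** K2 = - K2" "K ** K = K2"
  proof -
    show a: "K2 ** K = - K" 
      using hat_cubed[of k] assms by (simp add: K_def K2_def)
    then show b: "K ** K2 = - K" by (simp add: K2_def matrix_mul_assoc)
    have "K2 ** K2 = (K2 ** K) ** K" by (simp add: K2_def matrix_mul_assoc)
    also have "\<dots> = - K2"
      by (simp add: a) (simp add: K2_def linear_neg[OF linear_matrix_mul_right])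
    finally show "K2 ** K2 = - K2" .
  qed (simp add: K2_def)
  have "rodrigues k x ** rodrigues k y =
      mat 1 + (sin x * cos y + cos x * sin y) *\<^sub>R K + (1 - (cos x * cos y - sin x * sin y)) *\<^sub>R K2"
    unfolding rodrigues_def K_def[symmetric] K2_def[symmetric]
    by (simp add: linear_add[OF linear_matrix_mul_left] linear_add[OF linear_matrix_mul_right]
        linear_scale[OF linear_matrix_mul_left] linear_scale[OF linear_matrix_mul_right] K3)
       (simp add: algebra_simps)
  then show ?thesis
    by (simp add: rodrigues_def K_def K2_def sin_add cos_add)
qed

lemma transpose_rodrigues: "transpose (rodrigues k x) = rodrigues k (- x)"
proof -
  have "transpose (hat k ** hat k) = hat k ** hat k"
    by (simp add: matrix_transpose_mul transpose_hat linear_neg[OF linear_matrix_mul_left]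
        linear_neg[OF linear_matrix_mul_right])
  moreover have "transpose (M + N) = transpose M + transpose N"
    "transpose (c *\<^sub>R M) = c *\<^sub>R transpose M" for M N :: mat3 and c
    by (simp_all add: transpose_def vec_eq_iff)
  ultimately show ?thesis
    by (simp add: rodrigues_def transpose_hat)
qed

lemma rodrigues_zero [simp]: "rodrigues k 0 = mat 1"
  by (simp add: rodrigues_def)

lemma rodrigues_SO3:
  assumes "norm k = 1"
  shows "rodrigues k x \<in> SO3"
proof -
  have "orthogonal_matrix (rodrigues k x)"
    by (simp add: orthogonal_matrix transpose_rodrigues rodrigues_add[OF assms])
  \<comment> \<open>Halving the angle exhibits the determinant as a square, which excludes the value
    -1.\<close>
  moreover have "rodrigues k x = rodrigues k (x/2) ** rodrigues k (x/2)"
    by (simp add: rodrigues_add[OF assms])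
  then have "det (rodrigues k x) = (det (rodrigues k (x/2)))\<^sup>2"
    by (simp add: det_mul power2_eq_square)
  then have "det (rodrigues k x) \<ge> 0" by simp
  ultimately show ?thesis
    using det_orthogonal_matrix by (fastforce simp: SO3_def rotation_matrix_def)
qed

lemma smooth_curve_trig:
  "smooth_curve (\<lambda>t. p + sin (\<theta> * t) *\<^sub>R v + cos (\<theta> * t) *\<^sub>R w)"
proof -
  \<comment> \<open>Each differentiation multiplies by \<theta> and advances the phase by a quarter
    turn; the constant \<open>p\<close> survives only in order 0.\<close>
  define D where "D n t = (if n = 0 then p else 0) +
    \<theta>^n *\<^sub>R (sin (\<theta> * t + n * (pi/2)) *\<^sub>R v + cos (\<theta> * t + n * (pi/2)) *\<^sub>R w)" for n :: nat and t
  have "D 0 = (\<lambda>t. p + sin (\<theta> * t) *\<^sub>R v + cos (\<theta> * t) *\<^sub>R w)"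
    by (simp add: D_def fun_eq_iff add.assoc)
  moreover have "(D n has_vector_derivative D (Suc n) t) (at t)" for n t
  proof -
    have shift: "sin (\<theta> * t + Suc n * (pi/2)) = cos (\<theta> * t + n * (pi/2))"
      "cos (\<theta> * t + Suc n * (pi/2)) = - sin (\<theta> * t + n * (pi/2))"
      using sin_add[of "\<theta> * t + n * (pi/2)" "pi/2"] cos_add[of "\<theta> * t + n * (pi/2)" "pi/2"]
      by (simp_all add: algebra_simps add_divide_distrib)
    show ?thesis
      unfolding D_def shift
      by (auto intro!: derivative_eq_intros simp: algebra_simps)
  qed
  ultimately show ?thesis unfolding smooth_curve_def by blast
qed

text \<open>Turn the attitude about the axis of \<open>w\<close> at speed \<open>norm w\<close>,
  keeping \<open>b\<close> and \<open>C\<close> fixed.\<close>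

lemma curve_through_state:
  assumes "\<eta> \<in> manifold_M" "\<eta> = ((R, b), C)"
  shows "\<exists>\<gamma>. curve_with_velocity manifold_M \<eta> ((R ** hat w, 0), 0) \<gamma>"
proof -
  obtain k where k: "norm k = 1" "w = norm w *\<^sub>R k"
  \<comment> \<open>At speed zero any unit vector can serve as the axis.\<close>
  proof (cases "w = 0")
    case True
    then show ?thesis using that[of "axis 1 1"] by simp
  next
    case False
    then show ?thesis using that[of "w /\<^sub>R norm w"] by simp
  qed
  define \<gamma> where "\<gamma> t = ((R ** rodrigues k (norm w * t), b), C)" for t
  define V where "V = ((R ** hat k, 0::real^3), 0::mat3)"
  define W where "W = ((R ** (hat k ** hat k), 0::real^3), 0::mat3)"
  \<comment> \<open>The factor 1 - cos splits: its constant part shifts the base point by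
    \<open>W\<close>, its cosine part contributes \<open>- W\<close>.\<close>
  have \<gamma>: "\<gamma> = (\<lambda>t. (\<eta> + W) + sin (norm w * t) *\<^sub>R V + cos (norm w * t) *\<^sub>R (- W))"
    by (simp add: \<gamma>_def V_def W_def assms(2) fun_eq_iff rodrigues_def
        linear_add[OF linear_matrix_mul_left] linear_scale[OF linear_matrix_mul_left]
        linear_diff[OF linear_matrix_mul_left] algebra_simps)
  have "curve_with_velocity manifold_M \<eta> ((R ** hat w, 0), 0) \<gamma>"
    unfolding curve_with_velocity_def
  proof (intro conjI)
    show "smooth_curve \<gamma>" unfolding \<gamma> by (rule smooth_curve_trig)
    show "range \<gamma> \<subseteq> manifold_M"
      using assms by (auto simp: \<gamma>_def manifold_M_def intro: SO3_closed rodrigues_SO3[OF k(1)])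
    show "\<gamma> 0 = \<eta>" by (simp add: \<gamma>_def assms(2))
    have "hat w = norm w *\<^sub>R hat k" by (metis k(2) hat_scaleR)
    then have "((R ** hat w, 0), 0) = norm w *\<^sub>R V"
      by (simp add: V_def linear_scale[OF linear_matrix_mul_left])
    \<comment> \<open>At time 0 the derivative of the cosine vanishes, so only the sine term
      contributes.\<close>
    then show "(\<gamma> has_vector_derivative ((R ** hat w, 0), 0)) (at 0)"
      unfolding \<gamma> by (auto intro!: derivative_eq_intros)
  qed
  then show ?thesis by blast
qed

text \<open>The chain rule gives existence. The curve \<gamma> gives uniqueness: if no curve had
  velocity \<open>v\<close>, every value would satisfy the description vacuously.\<close>

lemma differential_affine:
  assumes "curve_with_velocity S p v \<gamma>" "bounded_linear L" "\<And>x. F x = L x + c"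
  shows "differential S F p v = L v"
  unfolding differential_def
proof (rule the_equality)
  have *: "(F \<circ> \<beta> has_vector_derivative L v) (at 0)" if "curve_with_velocity S p v \<beta>" for \<beta>
  proof -
    have "((\<lambda>t. L (\<beta> t)) has_vector_derivative L v) (at 0)"
      using that assms(2)
      by (auto simp: curve_with_velocity_def intro: bounded_linear.has_vector_derivative)
    then show ?thesis by (auto simp: o_def assms(3) intro!: derivative_eq_intros)
  qed
  then show "\<forall>\<beta>. curve_with_velocity S p v \<beta> \<longrightarrow> (F \<circ> \<beta> has_vector_derivative L v) (at 0)"
    by blast
  show "w = L v"
    if "\<forall>\<beta>. curve_with_velocity S p v \<beta> \<longrightarrow> (F \<circ> \<beta> has_vector_derivative w) (at 0)" for w
    using that *[OF assms(1)] assms(1) vector_derivative_unique_at by blast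
qed

lemma differential_phi:
  assumes "curve_with_velocity S \<eta> ((P, q), Q) \<gamma>"
  shows "differential S (phi ((A, a), B)) \<eta> ((P, q), Q) =
    ((P ** A, transpose A *v q), transpose A ** Q ** B)"
proof -
  define L :: "state \<Rightarrow> state" where
    "L = (\<lambda>\<xi>. ((fst (fst \<xi>) ** A, transpose A *v snd (fst \<xi>)), transpose A ** snd \<xi> ** B))"
  have "linear L"
    unfolding L_def
    by (rule linearI)
       (simp_all add: linear_add[OF linear_matrix_mul_left] linear_add[OF linear_matrix_mul_right]
        linear_scale[OF linear_matrix_mul_left] linear_scale[OF linear_matrix_mul_right]
        matrix_vector_right_distrib matrix_vector_mult_scaleR del: transpose_matrix_vector)
  then have "bounded_linear L" by (simp add: linear_conv_bounded_linear)
  \<comment> \<open>Only the translation of the bias by \<open>vee a\<close> is not linear, and it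
    adds a constant.\<close>
  moreover have "phi ((A, a), B) \<xi> = L \<xi> + ((0, - (transpose A *v vee a)), 0)" for \<xi>
    by (cases \<xi> rule: prod.exhaust[case_product prod.exhaust])
       (auto simp: L_def matrix_vector_mult_diff_distrib simp del: transpose_matrix_vector)
  ultimately have "differential S (phi ((A, a), B)) \<eta> ((P, q), Q) = L ((P, q), Q)"
    by (rule differential_affine[OF assms])
  then show ?thesis by (simp add: L_def)
qed

theorem theorem4p2p5:
  fixes X :: symmetry and u :: input and \<xi> :: state
  assumes "X \<in> carrier symmetry_G" and "u \<in> inputs_L" and "\<xi> \<in> manifold_M"
  shows "f_sys (psi X u) \<xi> = induced_action X (f_sys u) \<xi>"
proof -
  obtain A a B where X: "X = ((A, a), B)" and A: "A \<in> SO3" and a: "a \<in> so3"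
    using assms(1) by (auto simp: carrier_symmetry_G)
  obtain \<omega> where u: "u = (\<omega>, 0, 0)" using assms(2) by (auto simp: inputs_L_def)
  obtain R b C where \<xi>: "\<xi> = ((R, b), C)" by (metis prod.exhaust)
  have AT: "transpose A \<in> SO3" using A by (rule SO3_closed)
  have inv_closed: "inv\<^bsub>symmetry_G\<^esub> X \<in> carrier symmetry_G"
    using assms(1) by (rule group.inv_closed[OF symmetry_G_group])
  define \<eta> where "\<eta> = phi (inv\<^bsub>symmetry_G\<^esub> X) \<xi>"
  have \<eta>M: "\<eta> \<in> manifold_M"
    using phi_right_action inv_closed assms(3) by (simp add: right_action_def \<eta>_def)
  \<comment> \<open>Writing the algebra component of the inverse as a \<open>hat\<close> lets
    \<open>vee\<close> be read off.\<close>
  have "- (transpose A ** a ** A) = hat (- (transpose A *v vee a))"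
    using hat_conj[OF AT, of "vee a"] hat_scaleR[of "-1"] hat_vee[OF a]
    by (simp del: transpose_matrix_vector)
  then have "vee (- (transpose A ** a ** A)) = - (transpose A *v vee a)"
    by (metis vee_hat)
  then have \<eta>: "\<eta> = ((R ** transpose A, A *v b + vee a), A ** C ** transpose B)"
    using assms(1)
    by (simp add: \<eta>_def X \<xi> inv_symmetry_G matrix_vector_right_distrib
        matrix_vector_mul_assoc SO3_D[OF A] del: transpose_matrix_vector)
  \<comment> \<open>The bias-corrected angular velocity at \<eta>.\<close>
  define w where "w = \<omega> - (A *v b + vee a)"
  have f\<eta>: "f_sys u \<eta> = ((R ** transpose A ** hat w, 0), 0)"
    by (simp add: u \<eta> w_def)
  obtain \<gamma> where "curve_with_velocity manifold_M \<eta> (f_sys u \<eta>) \<gamma>"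
    using curve_through_state[OF \<eta>M \<eta>] f\<eta> by auto
  then have "induced_action X (f_sys u) \<xi> =
      ((R ** transpose A ** hat w ** A, transpose A *v 0), transpose A ** 0 ** B)"
    using differential_phi[of manifold_M] by (simp add: induced_action_def X f\<eta> flip: \<eta>_def[unfolded X])
  \<comment> \<open>The last factor \<open>A\<close> is written as a double transpose to match
    \<open>hat_conj\<close> for the rotation \<open>transpose A\<close>.\<close>
  also have "\<dots> = ((R ** (transpose A ** hat w ** transpose (transpose A)), 0), 0)"
    by (simp add: matrix_mul_assoc linear_0[OF linear_matrix_mul_left]
        linear_0[OF linear_matrix_mul_right] del: transpose_matrix_vector)
  also have "\<dots> = ((R ** hat (transpose A *v w), 0), 0)"
    by (simp only: hat_conj[OF AT])
  \<comment> \<open>The rotations cancel on \<open>b\<close>, leaving the transformed input minus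
    the original bias.\<close>
  also have "transpose A *v w = transpose A *v (\<omega> - vee a) - b"
    by (simp add: w_def matrix_vector_mult_diff_distrib matrix_vector_right_distrib
        matrix_vector_mul_assoc SO3_D[OF A] del: transpose_matrix_vector)
  finally show ?thesis
    by (simp add: X u \<xi> del: transpose_matrix_vector)
qed

end
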